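(* Let $K,H$ be finite dimensional Hilbert spaces and let $\phi:B(K)\to B(H)$ be a self-adjoint linear map (i.e. $\phi(a)$ is self-adjoint whenever $a$ is self-adjoint) such that $-\phi$ is not completely positive. Write $C_\phi = C_\phi^+ - C_\phi^-$ for the decomposition of the self-adjoint Choi matrix $C_\phi$ into positive operators with orthogonal supports. Then: (i) There exists a completely positive map $\phi_{cp}:B(K)\to B(H)$ such that $\|C_\phi^+\|^{-1}\phi = \mathrm{Tr} - \phi_{cp}$, where $\mathrm{Tr}$ denotes the map $x\mapsto \mathrm{Tr}(x)1_H$. (ii) If $\mathcal{C}$ is a mapping cone on $B(H)$ containing $CP$, then $\phi$ is $\mathcal{C}$-positive if and only if $$\|\phi_{cp}\|_{\mathcal{C}} = \sup \rho(C_{\phi_{cp}}) \le 1,$$ where the supremum is taken over all states $\rho$ on $B(K\otimes H)$ whose density operator is $C_\psi$ for some $\psi\in \mathcal{P}_{\mathcal{C}}^o$.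
   Context: $K,H$ are finite dimensional Hilbert spaces; $B(K\otimes H)$ is identified with $B(K)\otimes B(H)$. Fix matrix units $(e_{ij})$ for $B(K)$ (from an orthonormal basis), and let $t$ denote the transpose on $B(H)$ with respect to a fixed orthonormal basis. The Choi matrix of a linear map $\phi:B(K)\to B(H)$ is $C_\phi=\sum_{i,j} e_{ij}\otimes\phi(e_{ij})\in B(K\otimes H)$; $\phi$ is completely positive iff $C_\phi\ge 0$. To $\phi$ associate the linear functional $\tilde\phi$ on $B(K\otimes H)$ with $\tilde\phi(a\otimes b)=\mathrm{Tr}(\phi(a)b^t)$. Let $P(H)$ be the positive linear maps $B(H)\to B(H)$ and $CP$ the completely positive ones. A mapping cone is a closed cone $\mathcal{C}\subset P(H)$ with $\alpha\circ\phi\circ\beta\in\mathcal{C}$ for all $\phi\in\mathcal{C}$, $\alpha,\beta\in CP$. Set $P(B(K),\mathcal{C})=\{a\in B(K\otimes H): (\iota\otimes\alpha)(a)\ge 0\ \forall\alpha\in\mathcal{C}\}$ ($\iota$ the identity on $B(K)$). A map $\phi:B(K)\to B(H)$ is $\mathcal{C}$-positive if $\tilde\phi(a)\ge 0$ for all $a\in P(B(K),\mathcal{C})$; $\mathcal{P}_{\mathcal{C}}$ denotes the cone of $\mathcal{C}$-positive maps, and its dual cone is $\mathcal{P}_{\mathcal{C}}^o=\{\psi:B(K)\to B(H)\text{ linear}: \mathrm{Tr}(C_\psi C_\chi)\ge 0\ \forall\chi\in\mathcal{P}_{\mathcal{C}}\}$. The norm $\|\cdot\|_{\mathcal{C}}$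 on linear maps $B(K)\to B(H)$ is $\|\phi\|_{\mathcal{C}}=\sup\{|\mathrm{Tr}(C_\phi C_\psi)|:\psi\in\mathcal{P}_{\mathcal{C}}^o,\ \mathrm{Tr}(C_\psi)=1\}$. A state $\rho$ has density operator $D$ if $\rho(x)=\mathrm{Tr}(Dx)$. *)

theory Defs
  imports Complex_Main "HOL-Library.Complex_Order" "Jordan_Normal_Form.Matrix"
begin

text \<open>Conventions. K = C^k, H = C^h with their standard orthonormal bases; B(K) is
  represented by complex k x k matrices (carrier_mat k k). A linear map B(K) -> B(H)
  is a function on complex matrices that maps carrier_mat k k linearly into
  carrier_mat h h (values outside carrier_mat k k are irrelevant).
  B(K (x) H) = B(K) (x) B(H) is represented by (k*h) x (k*h) matrices with the
  product basis e_i (x) f_p indexed by i*h + p.\<close>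

definition mtrace :: "complex mat \<Rightarrow> complex" where
  "mtrace A = (\<Sum>i<dim_row A. A $$ (i,i))"

definition adj :: "complex mat \<Rightarrow> complex mat" where
  "adj A = mat (dim_col A) (dim_row A) (\<lambda>(i,j). cnj (A $$ (j,i)))"

definition self_adj :: "nat \<Rightarrow> complex mat \<Rightarrow> bool" where
  "self_adj n A \<longleftrightarrow> A \<in> carrier_mat n n \<and> adj A = A"

definition cinner :: "nat \<Rightarrow> complex vec \<Rightarrow> complex vec \<Rightarrow> complex" where
  "cinner n v w = (\<Sum>i<n. cnj (v $ i) * w $ i)"

text \<open>Positive (semidefinite) operator: A \<ge> 0.  The order on complex is the one
  of HOL-Library.Complex_Order, so 0 \<le> z means z is real and nonnegative.\<close>
definition psd :: "nat \<Rightarrow> complex mat \<Rightarrow> bool" where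
  "psd n A \<longleftrightarrow> A \<in> carrier_mat n n \<and> (\<forall>v \<in> carrier_vec n. 0 \<le> cinner n v (A *\<^sub>v v))"

definition vnorm :: "nat \<Rightarrow> complex vec \<Rightarrow> real" where
  "vnorm n v = sqrt (\<Sum>i<n. (cmod (v $ i))\<^sup>2)"

definition op_norm :: "nat \<Rightarrow> complex mat \<Rightarrow> real" where
  "op_norm n A = Sup {vnorm n (A *\<^sub>v v) | v. v \<in> carrier_vec n \<and> vnorm n v \<le> 1}"

definition munit :: "nat \<Rightarrow> nat \<Rightarrow> nat \<Rightarrow> complex mat" where
  "munit n i j = mat n n (\<lambda>(a,b). if a = i \<and> b = j then 1 else 0)"

definition lin_map :: "nat \<Rightarrow> nat \<Rightarrow> (complex mat \<Rightarrow> complex mat) \<Rightarrow> bool" where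
  "lin_map k h \<phi> \<longleftrightarrow>
     (\<forall>a \<in> carrier_mat k k. \<phi> a \<in> carrier_mat h h) \<and>
     (\<forall>a \<in> carrier_mat k k. \<forall>b \<in> carrier_mat k k. \<phi> (a + b) = \<phi> a + \<phi> b) \<and>
     (\<forall>c. \<forall>a \<in> carrier_mat k k. \<phi> (c \<cdot>\<^sub>m a) = c \<cdot>\<^sub>m \<phi> a)"

definition self_adjoint_map :: "nat \<Rightarrow> nat \<Rightarrow> (complex mat \<Rightarrow> complex mat) \<Rightarrow> bool" where
  "self_adjoint_map k h \<phi> \<longleftrightarrow> lin_map k h \<phi> \<and>
     (\<forall>a. self_adj k a \<longrightarrow> self_adj h (\<phi> a))"

definition positive_map :: "nat \<Rightarrow> nat \<Rightarrow> (complex mat \<Rightarrow> complex mat) \<Rightarrow> bool" where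
  "positive_map k h \<phi> \<longleftrightarrow> lin_map k h \<phi> \<and> (\<forall>a. psd k a \<longrightarrow> psd h (\<phi> a))"

definition blk :: "nat \<Rightarrow> complex mat \<Rightarrow> nat \<Rightarrow> nat \<Rightarrow> complex mat" where
  "blk m a i j = mat m m (\<lambda>(p,q). a $$ (i * m + p, j * m + q))"

text \<open>(iota_n (x) alpha)(a) for alpha : B(C^m) -> B(C^m'), a in B(C^n (x) C^m).\<close>
definition ampl :: "nat \<Rightarrow> nat \<Rightarrow> nat \<Rightarrow> (complex mat \<Rightarrow> complex mat) \<Rightarrow> complex mat \<Rightarrow> complex mat" where
  "ampl n m m' \<alpha> a = mat (n * m') (n * m')
     (\<lambda>(r,s). \<alpha> (blk m a (r div m') (s div m')) $$ (r mod m', s mod m'))"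

definition CP :: "nat \<Rightarrow> nat \<Rightarrow> (complex mat \<Rightarrow> complex mat) \<Rightarrow> bool" where
  "CP k h \<phi> \<longleftrightarrow> lin_map k h \<phi> \<and>
     (\<forall>n a. psd (n * k) a \<longrightarrow> psd (n * h) (ampl n k h \<phi> a))"

definition choi :: "nat \<Rightarrow> nat \<Rightarrow> (complex mat \<Rightarrow> complex mat) \<Rightarrow> complex mat" where
  "choi k h \<phi> = mat (k * h) (k * h)
     (\<lambda>(r,s). \<phi> (munit k (r div h) (s div h)) $$ (r mod h, s mod h))"

text \<open>The functional phi~ on B(K (x) H): the linear extension of
  a (x) b \<mapsto> Tr(phi(a) b^t), evaluated on a = sum_ij e_ij (x) a_ij.\<close>
definition tilde :: "nat \<Rightarrow> nat \<Rightarrow> (complex mat \<Rightarrow> complex mat) \<Rightarrow> complex mat \<Rightarrow> complex" where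
  "tilde k h \<phi> a = (\<Sum>i<k. \<Sum>j<k. mtrace (\<phi> (munit k i j) * transpose_mat (blk h a i j)))"

text \<open>Mapping cone on B(C^h): a closed (convex) cone of positive maps closed under
  composition with completely positive maps on both sides.  Closedness is w.r.t. the
  (unique Hausdorff vector space) topology of linear maps, i.e. entrywise pointwise
  convergence on B(C^h).\<close>
definition mapping_cone :: "nat \<Rightarrow> (complex mat \<Rightarrow> complex mat) set \<Rightarrow> bool" where
  "mapping_cone h \<C> \<longleftrightarrow>
     \<C> \<subseteq> {\<phi>. positive_map h h \<phi>} \<and>
     (\<forall>\<phi> \<in> \<C>. \<forall>\<psi> \<in> \<C>. (\<lambda>x. \<phi> x + \<psi> x) \<in> \<C>) \<and>
     (\<forall>\<phi> \<in> \<C>. \<forall>t::real. t \<ge> 0 \<longrightarrow> (\<lambda>x. complex_of_real t \<cdot>\<^sub>m \<phi> x) \<in> \<C>) \<and>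
     (\<forall>\<phi>s \<phi>. (\<forall>n. \<phi>s n \<in> \<C>) \<and> lin_map h h \<phi> \<and>
        (\<forall>x \<in> carrier_mat h h. \<forall>i<h. \<forall>j<h. (\<lambda>n. \<phi>s n x $$ (i,j)) \<longlonglongrightarrow> \<phi> x $$ (i,j))
        \<longrightarrow> \<phi> \<in> \<C>) \<and>
     (\<forall>\<phi> \<in> \<C>. \<forall>\<alpha> \<beta>. CP h h \<alpha> \<and> CP h h \<beta> \<longrightarrow> \<alpha> \<circ> \<phi> \<circ> \<beta> \<in> \<C>)"

definition PBC :: "nat \<Rightarrow> nat \<Rightarrow> (complex mat \<Rightarrow> complex mat) set \<Rightarrow> complex mat set" where
  "PBC k h \<C> = {a \<in> carrier_mat (k * h) (k * h). \<forall>\<alpha> \<in> \<C>. psd (k * h) (ampl k h h \<alpha> a)}"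

definition C_positive :: "nat \<Rightarrow> nat \<Rightarrow> (complex mat \<Rightarrow> complex mat) set \<Rightarrow> (complex mat \<Rightarrow> complex mat) \<Rightarrow> bool" where
  "C_positive k h \<C> \<phi> \<longleftrightarrow> lin_map k h \<phi> \<and> (\<forall>a \<in> PBC k h \<C>. 0 \<le> tilde k h \<phi> a)"

definition P_C_dual :: "nat \<Rightarrow> nat \<Rightarrow> (complex mat \<Rightarrow> complex mat) set \<Rightarrow> (complex mat \<Rightarrow> complex mat) set" where
  "P_C_dual k h \<C> = {\<psi>. lin_map k h \<psi> \<and>
     (\<forall>\<chi>. C_positive k h \<C> \<chi> \<longrightarrow> 0 \<le> mtrace (choi k h \<psi> * choi k h \<chi>))}"

definition C_norm :: "nat \<Rightarrow> nat \<Rightarrow> (complex mat \<Rightarrow> complex mat) set \<Rightarrow> (complex mat \<Rightarrow> complex mat) \<Rightarrow> real" where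
  "C_norm k h \<C> \<phi> = Sup {cmod (mtrace (choi k h \<phi> * choi k h \<psi>)) | \<psi>.
     \<psi> \<in> P_C_dual k h \<C> \<and> mtrace (choi k h \<psi>) = 1}"

definition density_op :: "nat \<Rightarrow> complex mat \<Rightarrow> bool" where
  "density_op n D \<longleftrightarrow> psd n D \<and> mtrace D = 1"

end

theory Submission
  imports Defs "HOL-Analysis.L2_Norm"
begin

text \<open>With n the norm of the positive part of the Choi matrix of \<phi>, the map Tr - \<phi>/n has the Choi
  matrix 1 - Cp/n + Cm/n, a sum of two positive matrices; n > 0 because otherwise -\<phi> would be
  completely positive.

  For the second part, \<phi>~(a) is the trace of the product of the Choi matrix of \<phi> and the transpose
  of a. So for a in P(B(K), \<C>) the transpose of a is the Choi matrix of an element of the dual cone,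
  and \<phi> is \<C>-positive iff it pairs nonnegatively with the whole dual cone; no separation theorem is
  needed. Since CP is contained in \<C>, the dual cone consists of completely positive maps, hence its
  elements have a positive trace or vanish, and after normalization the pairing with
  \<phi> = n (Tr - \<phi>cp) is nonnegative iff the pairing with \<phi>cp is at most 1.\<close>

section \<open>Index arithmetic for the product basis\<close>

lemma sum_lessThan_mult:
  fixes f :: "nat \<Rightarrow> 'a::comm_monoid_add"
  shows "(\<Sum>r<k * h. f r) = (\<Sum>i<k. \<Sum>p<h. f (i * h + p))"
proof (induction k)
  case (Suc k)
  have "{..<Suc k * h} = {..<k * h} \<union> {k * h..<k * h + h}"
    by auto
  then have "(\<Sum>r<Suc k * h. f r) = (\<Sum>r<k * h. f r) + sum f {k * h..<k * h + h}"
    by (simp add: sum.union_disjoint ivl_disj_int)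
  also have "sum f {k * h..<k * h + h} = (\<Sum>p<h. f (k * h + p))"
    using sum.shift_bounds_nat_ivl[of f 0 "k * h" h]
    by (simp add: add.commute atLeast0LessThan)
  finally show ?case
    using Suc by simp
qed simp

lemma mult_add_less_mult: "i * h + p < k * h" if "i < k" "p < h" for i p k h :: nat
proof -
  have "i * h + p < Suc i * h"
    using that by simp
  also have "\<dots> \<le> k * h"
    using that by (intro mult_right_mono) auto
  finally show ?thesis .
qed

section \<open>Positive semidefinite matrices\<close>

text \<open>The expression is the value of a sesquilinear form at x + t e, with q its value at x, b
  and c the two cross terms and d its value at e. Taking t = 0, 1, \<i> yields conjugate symmetry; t
  = -b/d, the minimizer, yields the Schur complement.\<close>

lemma complex_quadratic_nonneg:
  fixes q b c d :: complex
  assumes *: "\<And>t. 0 \<le> q + cnj t * b + t * c + t * cnj t * d"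
    and d: "0 \<le> d"
  shows "c = cnj b" "d = 0 \<Longrightarrow> b = 0" "0 \<le> q - b * c / d"
proof -
  have dr: "Im d = 0" "Re d \<ge> 0"
    using d by (auto simp: less_eq_complex_def)
  have q: "Im q = 0" "Re q \<ge> 0"
    using *[of 0] by (auto simp: less_eq_complex_def)
  have "Im b + Im c = 0"
    using *[of 1] q dr by (auto simp: less_eq_complex_def)
  moreover have "Re c - Re b = 0"
    using *[of \<i>] q dr by (auto simp: less_eq_complex_def)
  ultimately show c: "c = cnj b"
    by (simp add: complex_eq_iff)
  show b: "b = 0" if "d = 0"
  proof (rule ccontr)
    assume "b \<noteq> 0"
    \<comment> \<open>With M = |b|^2, the choice of s makes the value at t = -s b equal to q - 2 s M
      = -1, which contradicts nonnegativity.\<close>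
    define M where "M = Re b * Re b + Im b * Im b"
    define s where "s = (Re q + 1) / (2 * M)"
    have "M > 0"
      using \<open>b \<noteq> 0\<close> by (simp add: M_def complex_eq_iff sum_squares_gt_zero_iff)
    have "0 \<le> Re q - 2 * s * M"
      using *[of "- complex_of_real s * b"] that c
      by (simp add: M_def less_eq_complex_def algebra_simps)
    also have "2 * s * M = Re q + 1"
      using \<open>M > 0\<close> by (simp add: s_def)
    finally show False by simp
  qed
  show "0 \<le> q - b * c / d"
  proof (cases "d = 0")
    case True
    then show ?thesis using *[of 0] b by simp
  next
    case False
    have cd: "cnj d = d"
      using dr by (simp add: complex_eq_iff)
    have "q + cnj (- b / d) * b + (- b / d) * c + (- b / d) * cnj (- b / d) * d = q - b * c / d"
      using False by (simp add: c cd field_simps)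
    with *[of "- b / d"] show ?thesis by simp
  qed
qed

text \<open>Test vectors become arbitrary functions on indices. This removes carrier conditions and
  lets a test vector be built blockwise from another one.\<close>

lemma psd_iff_form:
  "psd n A \<longleftrightarrow> A \<in> carrier_mat n n \<and>
    (\<forall>x. 0 \<le> (\<Sum>r<n. \<Sum>s<n. cnj (x r) * A $$ (r,s) * x s))"
proof -
  have form: "cinner n v (A *\<^sub>v v) = (\<Sum>r<n. \<Sum>s<n. cnj (v $ r) * A $$ (r,s) * v $ s)"
    if "A \<in> carrier_mat n n" "v \<in> carrier_vec n" for v
    using that unfolding cinner_def
    by (auto simp: scalar_prod_def sum_distrib_left atLeast0LessThan mult.assoc intro!: sum.cong)
  have "(\<forall>v\<in>carrier_vec n. 0 \<le> cinner n v (A *\<^sub>v v)) \<longleftrightarrow>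
    (\<forall>x. 0 \<le> (\<Sum>r<n. \<Sum>s<n. cnj (x r) * A $$ (r,s) * x s))" if A: "A \<in> carrier_mat n n"
  proof
    assume L: "\<forall>v\<in>carrier_vec n. 0 \<le> cinner n v (A *\<^sub>v v)"
    show "\<forall>x. 0 \<le> (\<Sum>r<n. \<Sum>s<n. cnj (x r) * A $$ (r,s) * x s)"
    proof
      fix x :: "nat \<Rightarrow> complex"
      show "0 \<le> (\<Sum>r<n. \<Sum>s<n. cnj (x r) * A $$ (r,s) * x s)"
        using L[rule_format, of "vec n x"] form[OF A, of "vec n x"] by simp
    qed
  qed (use form[OF A] in simp)
  then show ?thesis
    unfolding psd_def by blast
qed

text \<open>Cholesky elimination: the Schur complement of the pivot again has a nonnegative form,
  and it vanishes on the pivot row and column. With division by 0 equal to 0 the formula is also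
  right for a zero pivot, whose row is zero.\<close>
lemma nonneg_form_factor_aux:
  fixes A :: "nat \<Rightarrow> nat \<Rightarrow> complex"
  assumes "m \<le> n"
    and "\<And>x. 0 \<le> (\<Sum>r<n. \<Sum>s<n. cnj (x r) * A r s * x s)"
    and "\<And>r s. r < n \<Longrightarrow> s < n \<Longrightarrow> m \<le> r \<or> m \<le> s \<Longrightarrow> A r s = 0"
  shows "\<exists>V. \<forall>r<n. \<forall>s<n. A r s = (\<Sum>l<m. V l r * cnj (V l s))"
  using assms
proof (induction m arbitrary: A)
  case 0
  then show ?case by auto
next
  case (Suc m)
  note nonneg = Suc.prems(2)
  have m: "m < n" using Suc.prems by simp
  \<comment> \<open>The matrix keeps its size n while m bounds its support, so the Schur complement
    meets the induction hypothesis without any change of index set. The pivot is the last index of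
    the support, and \<open>e\<close> is its unit vector.\<close>
  define e where "e = (\<lambda>r. if r = m then 1 else 0 :: complex)"
  have e_sum: "(\<Sum>r<n. e r * f r) = f m" for f
    using m by (simp add: e_def if_distrib[of "\<lambda>x. x * _"] cong: if_cong)
  define Q where "Q x = (\<Sum>r<n. \<Sum>s<n. cnj (x r) * A r s * x s)" for x
  define row where "row x = (\<Sum>s<n. A m s * x s)" for x
  define col where "col x = (\<Sum>r<n. cnj (x r) * A r m)" for x
  define A' where "A' r s = A r s - A r m * A m s / A m m" for r s
  have expand: "Q (\<lambda>r. x r + t * e r) = Q x + cnj t * row x + t * col x + t * cnj t * A m m" for x t
  proof -
    have "Q (\<lambda>r. x r + t * e r) = Q x
        + (\<Sum>r<n. \<Sum>s<n. cnj t * (e r * (A r s * x s)))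
        + (\<Sum>r<n. \<Sum>s<n. t * (e s * (cnj (x r) * A r s)))
        + (\<Sum>r<n. \<Sum>s<n. t * cnj t * (e r * (e s * A r s)))"
      unfolding Q_def sum.distrib[symmetric]
      by (intro sum.cong refl) (simp add: e_def algebra_simps)
    also have "(\<Sum>r<n. \<Sum>s<n. cnj t * (e r * (A r s * x s))) = cnj t * row x"
      by (simp add: row_def e_sum flip: sum_distrib_left)
    also have "(\<Sum>r<n. \<Sum>s<n. t * (e s * (cnj (x r) * A r s))) = t * col x"
      by (simp add: col_def e_sum flip: sum_distrib_left)
    also have "(\<Sum>r<n. \<Sum>s<n. t * cnj t * (e r * (e s * A r s))) = t * cnj t * A m m"
      by (simp add: e_sum flip: sum_distrib_left)
    finally show ?thesis .
  qed
  have "Q e = A m m"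
    using expand[of "\<lambda>_. 0" 1] by (simp add: Q_def row_def col_def)
  then have pivot: "0 \<le> A m m"
    using nonneg[of e] by (simp add: Q_def)
  have quad: "0 \<le> Q x + cnj t * row x + t * col x + t * cnj t * A m m" for x t
    using nonneg[of "\<lambda>r. x r + t * e r"] expand[of x t] by (simp add: Q_def)
  note schur = complex_quadratic_nonneg[OF quad pivot]
  \<comment> \<open>Evaluating at unit vectors turns facts on \<open>row x\<close> and
    \<open>col x\<close> into facts on entries: Hermitian symmetry, and a vanishing row for a zero
    pivot.\<close>
  have unit: "row (\<lambda>r. if r = s then 1 else 0) = A m s"
             "col (\<lambda>r. if r = s then 1 else 0) = A s m" if "s < n" for s
    using that by (simp_all add: row_def col_def if_distrib if_distribR cong: if_cong)
  have herm: "A s m = cnj (A m s)" if "s < n" for s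
    using schur(1)[of "\<lambda>r. if r = s then 1 else 0"] unit that by simp
  have zero: "A m s = 0" if "A m m = 0" "s < n" for s
    using schur(2)[of "\<lambda>r. if r = s then 1 else 0"] unit that by simp
  have "0 \<le> (\<Sum>r<n. \<Sum>s<n. cnj (x r) * A' r s * x s)" for x
  proof -
    have "row x * col x / A m m = col x * row x / A m m"
      by simp
    also have "\<dots> = (\<Sum>r<n. \<Sum>s<n. cnj (x r) * (A r m * A m s / A m m) * x s)"
      by (simp add: row_def col_def sum_product sum_divide_distrib mult.assoc)
    finally have "(\<Sum>r<n. \<Sum>s<n. cnj (x r) * A' r s * x s) = Q x - row x * col x / A m m"
      by (simp add: Q_def A'_def right_diff_distrib left_diff_distrib sum_subtractf)
    then show ?thesis using schur(3)[of x] by simp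
  qed
  moreover have "A' r s = 0" if "r < n" "s < n" "m \<le> r \<or> m \<le> s" for r s
  proof -
    \<comment> \<open>Row and column m are cancelled by the correction term, or are zero already if
      the pivot is. Beyond m, \<open>A r s\<close> vanishes and so does one factor of the
      correction.\<close>
    consider "r = m" | "s = m" | "Suc m \<le> r" | "Suc m \<le> s"
      using \<open>m \<le> r \<or> m \<le> s\<close> by linarith
    then show ?thesis
    proof cases
      case 1
      then show ?thesis using zero[of s] that by (cases "A m m = 0") (auto simp: A'_def)
    next
      case 2
      then show ?thesis using zero[of r] herm[of r] that
        by (cases "A m m = 0") (auto simp: A'_def)
    qed (use Suc.prems(3) that m in \<open>auto simp: A'_def\<close>)
  qed
  ultimately obtain V where V: "\<And>r s. r < n \<Longrightarrow> s < n \<Longrightarrow> A' r s = (\<Sum>l<m. V l r * cnj (V l s))"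
    using Suc.IH[of A'] m by (metis less_imp_le)
  \<comment> \<open>The new rank-one term is the pivot column divided by the square root of the
    pivot; for a zero pivot the division convention makes it zero.\<close>
  define d where "d = complex_of_real (sqrt (Re (A m m)))"
  have d: "d * cnj d = A m m"
    using pivot by (simp add: d_def less_eq_complex_def complex_eq_iff flip: of_real_mult)
  define V' where "V' = V(m := \<lambda>r. A r m / d)"
  have "A r s = (\<Sum>l<Suc m. V' l r * cnj (V' l s))" if "r < n" "s < n" for r s
  proof -
    have "A r s = A' r s + A r m * A m s / A m m"
      by (simp add: A'_def)
    also have "A r m * A m s / A m m = V' m r * cnj (V' m s)"
      using herm[of s] that by (simp add: V'_def flip: d)
    also have "A' r s = (\<Sum>l<m. V' l r * cnj (V' l s))"
      using V[OF that] by (simp add: V'_def)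
    finally show ?thesis by simp
  qed
  then show ?case by blast
qed

text \<open>For m = n the support condition is vacuous. This sum of n rank-one matrices takes the
  place of a spectral decomposition.\<close>

lemma psd_factor:
  assumes "psd n A"
  obtains V where "\<And>r s. r < n \<Longrightarrow> s < n \<Longrightarrow> A $$ (r,s) = (\<Sum>l<n. V l r * cnj (V l s))"
  using nonneg_form_factor_aux[of n n "\<lambda>r s. A $$ (r,s)"] assms
  unfolding psd_iff_form by (metis leD order_refl)

lemma psd_carrier: "psd n A \<Longrightarrow> A \<in> carrier_mat n n"
  by (simp add: psd_def)

text \<open>The form of the transpose at x is the form of \<open>A\<close> at the conjugate of
  x.\<close>

lemma psd_transpose:
  assumes "psd n A"
  shows "psd n (transpose_mat A)"
  unfolding psd_iff_form
proof (intro conjI allI)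
  show "transpose_mat A \<in> carrier_mat n n"
    using assms by (auto simp: psd_def)
  fix x
  have A: "A \<in> carrier_mat n n" using assms by (rule psd_carrier)
  have "0 \<le> (\<Sum>r<n. \<Sum>s<n. cnj (cnj (x r)) * A $$ (r,s) * cnj (x s))"
    using assms unfolding psd_iff_form by (elim conjE allE)
  also have "\<dots> = (\<Sum>r<n. \<Sum>s<n. cnj (x s) * transpose_mat A $$ (s,r) * x r)"
    using A by (intro sum.cong refl) (auto simp: algebra_simps)
  also have "\<dots> = (\<Sum>r<n. \<Sum>s<n. cnj (x r) * transpose_mat A $$ (r,s) * x s)"
    by (rule sum.swap)
  finally show "0 \<le> (\<Sum>r<n. \<Sum>s<n. cnj (x r) * transpose_mat A $$ (r,s) * x s)" .
qed

lemma psd_one: "psd n (1\<^sub>m n)"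
proof -
  have "(\<Sum>r<n. \<Sum>s<n. cnj (x r) * 1\<^sub>m n $$ (r,s) * x s) = (\<Sum>r<n. cnj (x r) * x r)" for x
    by (simp add: if_distrib if_distribR cong: if_cong)
  moreover have "0 \<le> (\<Sum>r<n. cnj (x r) * x r)" for x :: "nat \<Rightarrow> complex"
    by (intro sum_nonneg) (simp add: less_eq_complex_def)
  ultimately show ?thesis unfolding psd_iff_form by simp
qed

lemma psd_smult:
  assumes "psd n A" "0 \<le> c"
  shows "psd n (c \<cdot>\<^sub>m A)"
proof -
  have A: "A \<in> carrier_mat n n" using assms by (simp add: psd_def)
  have "(\<Sum>r<n. \<Sum>s<n. cnj (x r) * (c \<cdot>\<^sub>m A) $$ (r,s) * x s)
      = c * (\<Sum>r<n. \<Sum>s<n. cnj (x r) * A $$ (r,s) * x s)" for x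
    using A by (simp add: sum_distrib_left mult_ac)
  then show ?thesis using assms A unfolding psd_iff_form by simp
qed

lemma psd_add:
  assumes "psd n A" "psd n B"
  shows "psd n (A + B)"
proof -
  have A: "A \<in> carrier_mat n n" "B \<in> carrier_mat n n" using assms by (auto simp: psd_def)
  have "(\<Sum>r<n. \<Sum>s<n. cnj (x r) * (A + B) $$ (r,s) * x s)
      = (\<Sum>r<n. \<Sum>s<n. cnj (x r) * A $$ (r,s) * x s) + (\<Sum>r<n. \<Sum>s<n. cnj (x r) * B $$ (r,s) * x s)" for x
    using A by (simp add: sum.distrib algebra_simps)
  then show ?thesis using assms A unfolding psd_iff_form by simp
qed

section \<open>The trace and its positivity on products\<close>

lemma mtrace_smult: "A \<in> carrier_mat n n \<Longrightarrow> mtrace (c \<cdot>\<^sub>m A) = c * mtrace A"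
  by (auto simp: mtrace_def sum_distrib_left)

lemma mtrace_add:
  "A \<in> carrier_mat n n \<Longrightarrow> B \<in> carrier_mat n n \<Longrightarrow> mtrace (A + B) = mtrace A + mtrace B"
  by (auto simp: mtrace_def sum.distrib)

lemma mtrace_diff:
  "A \<in> carrier_mat n n \<Longrightarrow> B \<in> carrier_mat n n \<Longrightarrow> mtrace (A - B) = mtrace A - mtrace B"
  by (auto simp: mtrace_def sum_subtractf)

lemma mtrace_mult:
  assumes "A \<in> carrier_mat n n" "B \<in> carrier_mat n n"
  shows "mtrace (A * B) = (\<Sum>r<n. \<Sum>s<n. A $$ (r,s) * B $$ (s,r))"
  using assms by (auto simp: mtrace_def scalar_prod_def atLeast0LessThan)

text \<open>Writing \<open>B\<close> as a sum of rank-one matrices v v* makes the trace the sum of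
  the values of the form of \<open>A\<close> at the vectors v.\<close>

lemma mtrace_mult_psd_nonneg:
  assumes "psd n A" "psd n B"
  shows "0 \<le> mtrace (A * B)"
proof -
  obtain V where V: "\<And>r s. r < n \<Longrightarrow> s < n \<Longrightarrow> B $$ (r,s) = (\<Sum>l<n. V l r * cnj (V l s))"
    using psd_factor[OF assms(2)] by blast
  have "mtrace (A * B) = (\<Sum>r<n. \<Sum>s<n. \<Sum>l<n. cnj (V l r) * A $$ (r,s) * V l s)"
    using assms by (subst mtrace_mult[of _ n])
      (auto simp: psd_def V sum_distrib_left mult_ac intro!: sum.cong)
  also have "\<dots> = (\<Sum>r<n. \<Sum>l<n. \<Sum>s<n. cnj (V l r) * A $$ (r,s) * V l s)"
    by (intro sum.cong refl sum.swap)
  also have "\<dots> = (\<Sum>l<n. \<Sum>r<n. \<Sum>s<n. cnj (V l r) * A $$ (r,s) * V l s)"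
    by (rule sum.swap)
  also have "\<dots> \<ge> 0"
    using assms(1) unfolding psd_iff_form by - (rule sum_nonneg, blast)
  finally show ?thesis .
qed

section \<open>The operator norm\<close>

lemma vnorm_eq_L2_set: "vnorm n v = L2_set (\<lambda>i. cmod (v $ i)) {..<n}"
  by (simp add: vnorm_def L2_set_def)

lemma cinner_le_vnorm: "cmod (cinner n v w) \<le> vnorm n v * vnorm n w"
proof -
  have "cmod (cinner n v w) \<le> (\<Sum>i<n. \<bar>cmod (v $ i)\<bar> * \<bar>cmod (w $ i)\<bar>)"
    unfolding cinner_def by (rule order.trans[OF norm_sum]) (simp add: norm_mult)
  also have "\<dots> \<le> vnorm n v * vnorm n w"
    unfolding vnorm_eq_L2_set by (rule L2_set_mult_ineq)
  finally show ?thesis .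
qed

lemma vnorm_smult:
  "v \<in> carrier_vec n \<Longrightarrow> vnorm n (c \<cdot>\<^sub>v v) = cmod c * vnorm n v"
  by (auto simp: vnorm_eq_L2_set norm_mult L2_set_right_distrib intro!: L2_set_cong)

lemma cmod_le_vnorm: "i < n \<Longrightarrow> cmod (v $ i) \<le> vnorm n v"
  unfolding vnorm_eq_L2_set by (rule member_le_L2_set) auto

text \<open>The \<open>Sup\<close> defining the operator norm is an upper bound only for a bounded
  set; the sum of the moduli of all entries is a crude bound.\<close>

lemma bdd_above_op_norm:
  assumes "A \<in> carrier_mat n n"
  shows "bdd_above {vnorm n (A *\<^sub>v v) | v. v \<in> carrier_vec n \<and> vnorm n v \<le> 1}"
proof (rule bdd_aboveI)
  fix y
  assume "y \<in> {vnorm n (A *\<^sub>v v) | v. v \<in> carrier_vec n \<and> vnorm n v \<le> 1}"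
  then obtain v where v: "v \<in> carrier_vec n" "vnorm n v \<le> 1" and y: "y = vnorm n (A *\<^sub>v v)"
    by blast
  have "y \<le> (\<Sum>i<n. cmod ((A *\<^sub>v v) $ i))"
    unfolding y vnorm_eq_L2_set by (rule L2_set_le_sum) simp
  also have "\<dots> \<le> (\<Sum>i<n. \<Sum>j<n. cmod (A $$ (i,j)))"
  proof (rule sum_mono)
    fix i assume i: "i \<in> {..<n}"
    have "(A *\<^sub>v v) $ i = (\<Sum>j<n. A $$ (i,j) * v $ j)"
      using assms v i by (auto simp: scalar_prod_def atLeast0LessThan intro!: sum.cong)
    also have "cmod \<dots> \<le> (\<Sum>j<n. cmod (A $$ (i,j)))"
    proof (rule sum_norm_le)
      fix j assume "j \<in> {..<n}"
      then have "cmod (v $ j) \<le> 1"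
        using cmod_le_vnorm[of j n v] v by simp
      then show "cmod (A $$ (i,j) * v $ j) \<le> cmod (A $$ (i,j))"
        by (simp add: norm_mult mult_left_le)
    qed
    finally show "cmod ((A *\<^sub>v v) $ i) \<le> (\<Sum>j<n. cmod (A $$ (i,j)))" .
  qed
  finally show "y \<le> (\<Sum>i<n. \<Sum>j<n. cmod (A $$ (i,j)))" .
qed

lemma vnorm_mult_le_op_norm:
  assumes A: "A \<in> carrier_mat n n" and v: "v \<in> carrier_vec n"
  shows "vnorm n (A *\<^sub>v v) \<le> op_norm n A * vnorm n v"
proof (cases "vnorm n v = 0")
  case True
  then have "v $ i = 0" if "i < n" for i
    using cmod_le_vnorm[OF that, of v] by simp
  then have "v = 0\<^sub>v n" using v by auto
  then have "A *\<^sub>v v = 0\<^sub>v n" using A by auto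
  then show ?thesis using True by (simp add: vnorm_def)
next
  case False
  then have pos: "vnorm n v > 0"
    by (simp add: vnorm_def sum_nonneg order.strict_iff_order)
  define u where "u = complex_of_real (1 / vnorm n v) \<cdot>\<^sub>v v"
  have u: "u \<in> carrier_vec n" "vnorm n u \<le> 1"
    using v pos by (simp_all add: u_def vnorm_smult norm_divide)
  then have "vnorm n (A *\<^sub>v u) \<le> op_norm n A"
    unfolding op_norm_def by (intro cSup_upper bdd_above_op_norm A) blast
  moreover have "A *\<^sub>v u = complex_of_real (1 / vnorm n v) \<cdot>\<^sub>v (A *\<^sub>v v)"
    using A v by (simp add: u_def mult_mat_vec)
  moreover have "A *\<^sub>v v \<in> carrier_vec n"
    using A v by (rule mult_mat_vec_carrier)
  ultimately show ?thesis
    using pos by (simp add: vnorm_smult norm_divide field_simps)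
qed

text \<open>A nonzero entry in column j is visible in the image of the j-th unit vector.\<close>

lemma op_norm_pos:
  assumes A: "A \<in> carrier_mat n n" and "A \<noteq> 0\<^sub>m n n"
  shows "0 < op_norm n A"
proof (rule ccontr)
  assume neg: "\<not> 0 < op_norm n A"
  obtain i j where ij: "i < n" "j < n" "A $$ (i,j) \<noteq> 0"
    using assms by (metis eq_matI carrier_matD index_zero_mat)
  have "vnorm n (A *\<^sub>v unit_vec n j) \<le> op_norm n A * vnorm n (unit_vec n j)"
    using A by (intro vnorm_mult_le_op_norm) auto
  also have "\<dots> \<le> 0"
    using neg by (intro mult_nonpos_nonneg) (auto simp: vnorm_def sum_nonneg)
  finally have "cmod ((A *\<^sub>v unit_vec n j) $ i) \<le> 0"
    using cmod_le_vnorm[OF ij(1)] order.trans by blast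
  moreover have "(A *\<^sub>v unit_vec n j) $ i = A $$ (i,j)"
    using A ij by simp
  ultimately show False using ij by simp
qed

text \<open>By Cauchy-Schwarz the form of \<open>A\<close> at v is at most |v| |Av|, hence at most
  the norm of \<open>A\<close> times |v|^2.\<close>

lemma psd_op_norm_minus:
  assumes "psd n A"
  shows "psd n (complex_of_real (op_norm n A) \<cdot>\<^sub>m 1\<^sub>m n - A)"
  unfolding psd_def
proof (intro conjI ballI)
  have A: "A \<in> carrier_mat n n" using assms by (rule psd_carrier)
  let ?c = "complex_of_real (op_norm n A)"
  show "?c \<cdot>\<^sub>m 1\<^sub>m n - A \<in> carrier_mat n n" using A by (rule minus_carrier_mat)
  fix v :: "complex vec" assume v: "v \<in> carrier_vec n"
  have "(?c \<cdot>\<^sub>m 1\<^sub>m n - A) *\<^sub>v v = ?c \<cdot>\<^sub>v v - A *\<^sub>v v"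
    using A v by (subst minus_mult_distrib_mat_vec[of _ n n]) auto
  then have "cinner n v ((?c \<cdot>\<^sub>m 1\<^sub>m n - A) *\<^sub>v v) = ?c * (\<Sum>i<n. cnj (v $ i) * v $ i) - cinner n v (A *\<^sub>v v)"
    using A v by (simp add: cinner_def algebra_simps sum_subtractf sum_distrib_left)
  also have "(\<Sum>i<n. cnj (v $ i) * v $ i) = complex_of_real ((vnorm n v)\<^sup>2)"
    by (simp add: vnorm_def sum_nonneg complex_norm_square mult.commute del: of_real_power)
  finally have eq: "cinner n v ((?c \<cdot>\<^sub>m 1\<^sub>m n - A) *\<^sub>v v)
      = complex_of_real (op_norm n A * (vnorm n v)\<^sup>2) - cinner n v (A *\<^sub>v v)"
    by simp
  have nonneg: "0 \<le> cinner n v (A *\<^sub>v v)"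
    using assms v by (simp add: psd_def)
  have "cmod (cinner n v (A *\<^sub>v v)) \<le> vnorm n v * vnorm n (A *\<^sub>v v)"
    by (rule cinner_le_vnorm)
  also have "\<dots> \<le> vnorm n v * (op_norm n A * vnorm n v)"
    using vnorm_mult_le_op_norm[OF A v] by (intro mult_left_mono) (auto simp: vnorm_def sum_nonneg)
  finally have "cmod (cinner n v (A *\<^sub>v v)) \<le> op_norm n A * (vnorm n v)\<^sup>2"
    by (simp add: power2_eq_square mult_ac)
  then show "0 \<le> cinner n v ((?c \<cdot>\<^sub>m 1\<^sub>m n - A) *\<^sub>v v)"
    using nonneg complex_Re_le_cmod[of "cinner n v (A *\<^sub>v v)"]
    unfolding eq by (auto simp: less_eq_complex_def)
qed

text \<open>Pair \<open>A\<close> with the positive matrix \<parallel>B\<parallel> 1 - B. The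
  estimate later bounds the supremum over states and settles dual elements of trace zero.\<close>

lemma mtrace_mult_le_op_norm:
  assumes "psd n A" "psd n B"
  shows "mtrace (A * B) \<le> complex_of_real (op_norm n B) * mtrace A"
proof -
  have A: "A \<in> carrier_mat n n" "B \<in> carrier_mat n n" using assms by (auto simp: psd_def)
  let ?c = "complex_of_real (op_norm n B)"
  have "0 \<le> mtrace (A * (?c \<cdot>\<^sub>m 1\<^sub>m n - B))"
    using assms by (intro mtrace_mult_psd_nonneg[of n] psd_op_norm_minus)
  also have "A * (?c \<cdot>\<^sub>m 1\<^sub>m n - B) = ?c \<cdot>\<^sub>m A - A * B"
    using A by (subst mult_minus_distrib_mat[of _ n n _ n]) (auto simp: mult_smult_distrib[of _ n n _ n])
  also have "mtrace \<dots> = ?c * mtrace A - mtrace (A * B)"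
    using A by (simp add: mtrace_diff[of _ n] mtrace_smult[of _ n])
  finally show ?thesis by simp
qed

section \<open>The Choi matrix\<close>

lemma choi_carrier [simp]: "choi k h \<phi> \<in> carrier_mat (k * h) (k * h)"
  by (simp add: choi_def)

lemma choi_index:
  assumes "i < k" "j < k" "p < h" "q < h"
  shows "choi k h \<phi> $$ (i * h + p, j * h + q) = \<phi> (munit k i j) $$ (p, q)"
  using assms by (simp add: choi_def mult_add_less_mult)

text \<open>Inverse of the Choi correspondence on k x k matrices: by linearity the image of x is the
  sum of x_ij times the image of e_ij, and that image is block (i,j) of \<open>C\<close>.\<close>

definition map_of_choi :: "nat \<Rightarrow> nat \<Rightarrow> complex mat \<Rightarrow> complex mat \<Rightarrow> complex mat" where
  "map_of_choi k h C x =
    mat h h (\<lambda>(p,q). \<Sum>i<k. \<Sum>j<k. x $$ (i,j) * C $$ (i * h + p, j * h + q))"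

lemma lin_map_map_of_choi: "lin_map k h (map_of_choi k h C)"
  unfolding lin_map_def
proof (intro conjI ballI allI)
  fix a b :: "complex mat" and c
  assume a: "a \<in> carrier_mat k k"
  show "map_of_choi k h C a \<in> carrier_mat h h"
    by (simp add: map_of_choi_def)
  show "map_of_choi k h C (c \<cdot>\<^sub>m a) = c \<cdot>\<^sub>m map_of_choi k h C a"
    using a by (intro eq_matI) (auto simp: map_of_choi_def sum_distrib_left mult.assoc intro!: sum.cong)
  assume b: "b \<in> carrier_mat k k"
  show "map_of_choi k h C (a + b) = map_of_choi k h C a + map_of_choi k h C b"
    using a b by (intro eq_matI) (auto simp: map_of_choi_def sum.distrib[symmetric] algebra_simps intro!: sum.cong)
qed

lemma munit_carrier [simp]: "munit k i j \<in> carrier_mat k k"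
  by (simp add: munit_def)

lemma choi_map_of_choi:
  assumes C: "C \<in> carrier_mat (k * h) (k * h)"
  shows "choi k h (map_of_choi k h C) = C"
proof (rule eq_matI)
  fix r s assume "r < dim_row C" "s < dim_col C"
  then have rs: "r < k * h" "s < k * h" using C by auto
  then have h: "h > 0" by (cases h) auto
  have lt: "r div h < k" "s div h < k" "r mod h < h" "s mod h < h"
    using rs h by (simp_all add: less_mult_imp_div_less)
  have "choi k h (map_of_choi k h C) $$ (r, s) =
      (\<Sum>i<k. \<Sum>j<k. (if i = r div h \<and> j = s div h then 1 else 0) * C $$ (i * h + r mod h, j * h + s mod h))"
    using rs lt by (simp add: choi_def map_of_choi_def munit_def)
  also have "\<dots> = (\<Sum>i<k. if i = r div h then C $$ (i * h + r mod h, s div h * h + s mod h) else 0)"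
    using lt by (intro sum.cong refl) (simp add: if_distribR if_distrib cong: if_cong)
  also have "\<dots> = C $$ (r, s)"
    using lt by simp
  finally show "choi k h (map_of_choi k h C) $$ (r, s) = C $$ (r, s)" .
qed (use C in \<open>auto simp: choi_def\<close>)

text \<open>\<open>lin_map\<close> offers only binary additivity, so the expansion in matrix units
  goes by induction on a set S of positions that supports x, splitting off one entry at a
  time.\<close>

lemma lin_map_expand_aux:
  assumes lin: "lin_map k h \<phi>" and "finite S" "S \<subseteq> {..<k} \<times> {..<k}"
    and "x \<in> carrier_mat k k"
    and "\<And>i j. i < k \<Longrightarrow> j < k \<Longrightarrow> (i, j) \<notin> S \<Longrightarrow> x $$ (i, j) = 0"
  shows "\<phi> x = mat h h (\<lambda>(p, q). \<Sum>(i, j)\<in>S. x $$ (i, j) * \<phi> (munit k i j) $$ (p, q))"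
  using assms(2-)
proof (induction S arbitrary: x rule: finite_induct)
  case empty
  \<comment> \<open>That the zero matrix is mapped to zero follows from homogeneity with the scalar
    0.\<close>
  then have "x = 0 \<cdot>\<^sub>m x" by (intro eq_matI) auto
  then have "\<phi> x = 0 \<cdot>\<^sub>m \<phi> x"
    using lin empty.prems(2) unfolding lin_map_def by metis
  also have "\<phi> x \<in> carrier_mat h h"
    using lin empty.prems(2) unfolding lin_map_def by blast
  then have "0 \<cdot>\<^sub>m \<phi> x = 0\<^sub>m h h"
    by (intro eq_matI) auto
  finally have "\<phi> x = 0\<^sub>m h h" .
  then show ?case by (auto intro!: eq_matI)
next
  case (insert ij S)
  obtain i j where ij: "ij = (i, j)" by (cases ij)
  have lt: "i < k" "j < k" using insert.prems ij by auto
  define y where "y = mat k k (\<lambda>(a,b). if (a,b) = (i,j) then 0 else x $$ (a,b))"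
  have y: "y \<in> carrier_mat k k" by (simp add: y_def)
  have "x = y + x $$ (i,j) \<cdot>\<^sub>m munit k i j"
    using insert.prems(2) by (intro eq_matI) (auto simp: y_def munit_def)
  then have "\<phi> x = \<phi> y + x $$ (i,j) \<cdot>\<^sub>m \<phi> (munit k i j)"
    using lin y unfolding lin_map_def by (metis munit_carrier smult_carrier_mat)
  also have "\<phi> y = mat h h (\<lambda>(p, q). \<Sum>(a, b)\<in>S. y $$ (a, b) * \<phi> (munit k a b) $$ (p, q))"
    using insert.prems ij by (intro insert.IH y) (auto simp: y_def)
  also have "(\<lambda>(p, q). \<Sum>(a, b)\<in>S. y $$ (a, b) * \<phi> (munit k a b) $$ (p, q))
     = (\<lambda>(p, q). \<Sum>(a, b)\<in>S. x $$ (a, b) * \<phi> (munit k a b) $$ (p, q))"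
    using insert.hyps insert.prems ij by (intro ext) (auto simp: y_def intro!: sum.cong)
  finally have *: "\<phi> x = mat h h (\<lambda>(p, q). \<Sum>(a, b)\<in>S. x $$ (a, b) * \<phi> (munit k a b) $$ (p, q))
     + x $$ (i,j) \<cdot>\<^sub>m \<phi> (munit k i j)" .
  have "\<phi> (munit k i j) \<in> carrier_mat h h"
    using lin by (simp add: lin_map_def)
  then show ?case
    using insert.hyps ij unfolding * by (intro eq_matI) auto
qed

lemma map_of_choi_choi:
  assumes "lin_map k h \<phi>" "x \<in> carrier_mat k k"
  shows "map_of_choi k h (choi k h \<phi>) x = \<phi> x"
proof -
  have "\<phi> x = mat h h (\<lambda>(p, q). \<Sum>(i, j)\<in>{..<k} \<times> {..<k}. x $$ (i, j) * \<phi> (munit k i j) $$ (p, q))"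
    using assms by (intro lin_map_expand_aux) auto
  also have "\<dots> = map_of_choi k h (choi k h \<phi>) x"
    by (intro eq_matI) (auto simp: map_of_choi_def choi_index sum.cartesian_product[symmetric])
  finally show ?thesis by simp
qed

text \<open>One direction of Choi's theorem. A rank-one decomposition of the Choi matrix provides
  Kraus operators, so the form of the amplified matrix at y is a sum of values of the form of
  \<open>a\<close>.\<close>

lemma CP_of_psd_choi:
  assumes lin: "lin_map k h \<phi>" and C: "psd (k * h) (choi k h \<phi>)"
  shows "CP k h \<phi>"
  unfolding CP_def
proof (intro conjI allI impI)
  show "lin_map k h \<phi>" by (rule lin)
  fix n a assume a: "psd (n * k) a"
  obtain V where V: "\<And>r s. r < k * h \<Longrightarrow> s < k * h \<Longrightarrow>
      choi k h \<phi> $$ (r,s) = (\<Sum>l<k * h. V l r * cnj (V l s))"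
    using psd_factor[OF C] by blast
  show "psd (n * h) (ampl n k h \<phi> a)"
    unfolding psd_iff_form
  proof (intro conjI allI)
    show "ampl n k h \<phi> a \<in> carrier_mat (n * h) (n * h)" by (simp add: ampl_def)
    fix y :: "nat \<Rightarrow> complex"
    \<comment> \<open>\<open>w l\<close> is the image of y under the adjoint of the l-th Kraus
      operator, applied to the second tensor factor.\<close>
    define w where "w l r = (\<Sum>q<h. y (r div k * h + q) * cnj (V l (r mod k * h + q)))" for l r
    have ent: "ampl n k h \<phi> a $$ (m * h + p, m' * h + q) =
       (\<Sum>i<k. \<Sum>j<k. \<Sum>l<k * h. a $$ (m * k + i, m' * k + j) * (V l (i * h + p) * cnj (V l (j * h + q))))"
      if "m < n" "m' < n" "p < h" "q < h" for m m' p q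
    proof -
      have "ampl n k h \<phi> a $$ (m * h + p, m' * h + q) = \<phi> (blk k a m m') $$ (p, q)"
        using that by (simp add: ampl_def mult_add_less_mult)
      also have "\<phi> (blk k a m m') = map_of_choi k h (choi k h \<phi>) (blk k a m m')"
        by (rule map_of_choi_choi[OF lin, symmetric]) (simp add: blk_def)
      finally show ?thesis
        using that by (simp add: map_of_choi_def blk_def V mult_add_less_mult sum_distrib_left)
    qed
    have w: "w l (m * k + i) = (\<Sum>q<h. y (m * h + q) * cnj (V l (i * h + q)))" if "i < k" for l m i
      using that by (simp add: w_def)
    have "(\<Sum>r<n * h. \<Sum>s<n * h. cnj (y r) * ampl n k h \<phi> a $$ (r, s) * y s)
      = (\<Sum>m<n. \<Sum>p<h. \<Sum>m'<n. \<Sum>q<h. \<Sum>i<k. \<Sum>j<k. \<Sum>l<k * h. cnj (y (m * h + p)) *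
         (a $$ (m * k + i, m' * k + j) * (V l (i * h + p) * cnj (V l (j * h + q)))) * y (m' * h + q))"
      by (simp add: sum_lessThan_mult[of _ n h] ent sum_distrib_left sum_distrib_right)
    \<comment> \<open>The seven nested sums are flattened to one sum over tuples and permuted by a
      single bijection.\<close>
    also have "\<dots> = (\<Sum>l<k * h. \<Sum>m<n. \<Sum>i<k. \<Sum>m'<n. \<Sum>j<k. \<Sum>p<h. \<Sum>q<h. cnj (y (m * h + p)) *
         (a $$ (m * k + i, m' * k + j) * (V l (i * h + p) * cnj (V l (j * h + q)))) * y (m' * h + q))"
      unfolding sum.cartesian_product
      by (rule sum.reindex_bij_witness[where
            i = "\<lambda>(l,m,i,m',j,p,q). (m,p,m',q,i,j,l)" and j = "\<lambda>(m,p,m',q,i,j,l). (l,m,i,m',j,p,q)"])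
         auto
    also have "\<dots> = (\<Sum>l<k * h. \<Sum>m<n. \<Sum>i<k. \<Sum>m'<n. \<Sum>j<k.
         cnj (w l (m * k + i)) * a $$ (m * k + i, m' * k + j) * w l (m' * k + j))"
    proof (intro sum.cong refl)
      fix l m i m' j
      assume "i \<in> {..<k}" "j \<in> {..<k}"
      then have "cnj (w l (m * k + i)) * a $$ (m * k + i, m' * k + j) * w l (m' * k + j) =
          a $$ (m * k + i, m' * k + j) * ((\<Sum>p<h. cnj (y (m * h + p)) * V l (i * h + p)) *
          (\<Sum>q<h. y (m' * h + q) * cnj (V l (j * h + q))))"
        by (simp add: w)
      also have "\<dots> = (\<Sum>p<h. \<Sum>q<h. cnj (y (m * h + p)) *
         (a $$ (m * k + i, m' * k + j) * (V l (i * h + p) * cnj (V l (j * h + q)))) * y (m' * h + q))"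
        unfolding sum_product by (simp add: sum_distrib_left mult_ac)
      finally show "(\<Sum>p<h. \<Sum>q<h. cnj (y (m * h + p)) *
         (a $$ (m * k + i, m' * k + j) * (V l (i * h + p) * cnj (V l (j * h + q)))) * y (m' * h + q))
         = cnj (w l (m * k + i)) * a $$ (m * k + i, m' * k + j) * w l (m' * k + j)"
        by (rule sym)
    qed
    also have "\<dots> = (\<Sum>l<k * h. \<Sum>r<n * k. \<Sum>s<n * k. cnj (w l r) * a $$ (r, s) * w l s)"
      by (simp add: sum_lessThan_mult[of _ n k])
    also have "\<dots> \<ge> 0"
      using a unfolding psd_iff_form by - (rule sum_nonneg, blast)
    finally show "0 \<le> (\<Sum>r<n * h. \<Sum>s<n * h. cnj (y r) * ampl n k h \<phi> a $$ (r, s) * y s)" .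
  qed
qed

text \<open>The transpose on B(H) in the definition of the functional makes it the sum of the
  entrywise products of the Choi matrix and \<open>a\<close>; as the trace of a matrix product this
  needs the transpose of all of \<open>a\<close>.\<close>

lemma tilde_eq_mtrace:
  assumes lin: "lin_map k h \<phi>" and a: "a \<in> carrier_mat (k * h) (k * h)"
  shows "tilde k h \<phi> a = mtrace (transpose_mat a * choi k h \<phi>)"
proof -
  have "mtrace (\<phi> (munit k i j) * transpose_mat (blk h a i j)) =
     (\<Sum>p<h. \<Sum>q<h. choi k h \<phi> $$ (i * h + p, j * h + q) * a $$ (i * h + p, j * h + q))"
    if "i < k" "j < k" for i j
  proof -
    have "\<phi> (munit k i j) \<in> carrier_mat h h"
      using lin by (simp add: lin_map_def)
    then show ?thesis
      using that by (subst mtrace_mult[of _ h]) (auto simp: blk_def choi_index)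
  qed
  then have "tilde k h \<phi> a = (\<Sum>i<k. \<Sum>j<k. \<Sum>p<h. \<Sum>q<h.
      choi k h \<phi> $$ (i * h + p, j * h + q) * a $$ (i * h + p, j * h + q))"
    by (simp add: tilde_def)
  also have "\<dots> = (\<Sum>i<k. \<Sum>p<h. \<Sum>j<k. \<Sum>q<h.
      choi k h \<phi> $$ (i * h + p, j * h + q) * a $$ (i * h + p, j * h + q))"
    by (intro sum.cong refl sum.swap)
  also have "\<dots> = (\<Sum>r<k * h. \<Sum>s<k * h. choi k h \<phi> $$ (r,s) * a $$ (r,s))"
    by (simp add: sum_lessThan_mult)
  also have "\<dots> = (\<Sum>s<k * h. \<Sum>r<k * h. choi k h \<phi> $$ (r,s) * a $$ (r,s))"
    by (rule sum.swap)
  also have "\<dots> = mtrace (transpose_mat a * choi k h \<phi>)"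
    using a by (subst mtrace_mult[of _ "k * h"]) (auto simp: mult.commute[of "_ :: complex"])
  finally show ?thesis .
qed

section \<open>Duality for mapping cones\<close>

lemma ampl_id:
  assumes "a \<in> carrier_mat (n * h) (n * h)"
  shows "ampl n h h (\<lambda>x. x) a = a"
proof (rule eq_matI)
  fix r s assume "r < dim_row a" "s < dim_col a"
  then have "r < n * h" "s < n * h" using assms by auto
  moreover from this have "h > 0" by (cases h) auto
  ultimately show "ampl n h h (\<lambda>x. x) a $$ (r, s) = a $$ (r, s)"
    by (simp add: ampl_def blk_def)
qed (use assms in \<open>auto simp: ampl_def\<close>)

lemma CP_id: "CP h h (\<lambda>x. x)"
  by (auto simp: CP_def lin_map_def ampl_id psd_carrier)

text \<open>Test with the identity map, which is completely positive and hence lies in \<C>.\<close>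

lemma PBC_psd:
  assumes "{\<alpha>. CP h h \<alpha>} \<subseteq> \<C>" "a \<in> PBC k h \<C>"
  shows "psd (k * h) a"
proof -
  have "a \<in> carrier_mat (k * h) (k * h)" "psd (k * h) (ampl k h h (\<lambda>x. x) a)"
    using assms CP_id by (auto simp: PBC_def)
  then show ?thesis by (simp add: ampl_id)
qed

text \<open>The functional at \<open>a\<close> is the trace of a product of two positive matrices,
  the transpose of \<open>a\<close> and the Choi matrix.\<close>

lemma C_positive_of_psd_choi:
  assumes "{\<alpha>. CP h h \<alpha>} \<subseteq> \<C>" "lin_map k h \<chi>" "psd (k * h) (choi k h \<chi>)"
  shows "C_positive k h \<C> \<chi>"
  unfolding C_positive_def
proof (intro conjI ballI)
  fix a assume "a \<in> PBC k h \<C>"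
  then have "psd (k * h) a" using PBC_psd assms(1) by blast
  then show "0 \<le> tilde k h \<chi> a"
    using assms by (subst tilde_eq_mtrace)
      (auto intro!: mtrace_mult_psd_nonneg[of "k * h"] psd_transpose psd_carrier)
qed (rule assms)

text \<open>The rank-one matrices v v* suffice to test positivity of a matrix in the dual cone.\<close>
lemma P_C_dual_psd:
  assumes "{\<alpha>. CP h h \<alpha>} \<subseteq> \<C>" "\<psi> \<in> P_C_dual k h \<C>"
  shows "psd (k * h) (choi k h \<psi>)"
  unfolding psd_iff_form
proof (intro conjI allI)
  fix x :: "nat \<Rightarrow> complex"
  define X where "X = mat (k * h) (k * h) (\<lambda>(r,s). x r * cnj (x s))"
  have X: "X \<in> carrier_mat (k * h) (k * h)" by (simp add: X_def)
  have "psd (k * h) X"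
    unfolding psd_iff_form
  proof (intro conjI allI X)
    fix y
    have "(\<Sum>r<k * h. \<Sum>s<k * h. cnj (y r) * X $$ (r, s) * y s)
      = (\<Sum>r<k * h. cnj (y r) * x r) * cnj (\<Sum>r<k * h. cnj (y r) * x r)"
      by (simp add: X_def sum_product mult_ac)
    also have "\<dots> \<ge> 0"
      by (simp only: complex_norm_square[symmetric] less_eq_complex_def Re_complex_of_real
        Im_complex_of_real) simp
    finally show "0 \<le> (\<Sum>r<k * h. \<Sum>s<k * h. cnj (y r) * X $$ (r, s) * y s)" .
  qed
  \<comment> \<open>Realized as a Choi matrix, \<open>X\<close> belongs to a \<C>-positive map, so
    it may be paired with \<psi>; the pairing is the form at x.\<close>
  then have "C_positive k h \<C> (map_of_choi k h X)"
    using X assms(1) by (intro C_positive_of_psd_choi) (auto simp: lin_map_map_of_choi choi_map_of_choi)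
  then have "0 \<le> mtrace (choi k h \<psi> * X)"
    using assms(2) choi_map_of_choi[OF X] by (auto simp: P_C_dual_def)
  also have "\<dots> = (\<Sum>r<k * h. \<Sum>s<k * h. cnj (x r) * choi k h \<psi> $$ (r, s) * x s)"
    using X by (simp add: mtrace_mult[of _ "k * h"]) (simp add: X_def mult_ac)
  finally show "0 \<le> \<dots>" .
qed simp

text \<open>The pairing of the transpose of \<open>a\<close> with the Choi matrix of \<chi> is the
  functional of \<chi> at \<open>a\<close>, which is nonnegative by the definition of
  \<C>-positivity.\<close>

lemma transpose_PBC_dual:
  assumes "a \<in> PBC k h \<C>"
  shows "map_of_choi k h (transpose_mat a) \<in> P_C_dual k h \<C>"
proof -
  have a: "a \<in> carrier_mat (k * h) (k * h)" using assms by (simp add: PBC_def)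
  then have "choi k h (map_of_choi k h (transpose_mat a)) = transpose_mat a"
    by (intro choi_map_of_choi) auto
  then show ?thesis
    using assms a tilde_eq_mtrace by (auto simp: P_C_dual_def lin_map_map_of_choi C_positive_def)
qed

lemma P_C_dual_choi_smult:
  assumes "\<psi> \<in> P_C_dual k h \<C>" "0 \<le> c"
  shows "map_of_choi k h (c \<cdot>\<^sub>m choi k h \<psi>) \<in> P_C_dual k h \<C>"
proof -
  have "mtrace ((c \<cdot>\<^sub>m choi k h \<psi>) * choi k h \<chi>) = c * mtrace (choi k h \<psi> * choi k h \<chi>)" for \<chi>
    by (simp add: mtrace_mult[of _ "k * h"] sum_distrib_left mult.assoc choi_carrier[THEN carrier_matD(1)]
      choi_carrier[THEN carrier_matD(2)])
  then show ?thesis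
    using assms by (auto simp: P_C_dual_def lin_map_map_of_choi choi_map_of_choi)
qed

text \<open>One direction is the definition of the dual cone; for the other it is enough to test the
  dual elements that come from transposes of matrices in \<open>PBC k h \<C>\<close>.\<close>

lemma C_positive_iff_dual:
  assumes "lin_map k h \<phi>"
  shows "C_positive k h \<C> \<phi> \<longleftrightarrow>
    (\<forall>\<psi>\<in>P_C_dual k h \<C>. 0 \<le> mtrace (choi k h \<psi> * choi k h \<phi>))"
proof
  assume R: "\<forall>\<psi>\<in>P_C_dual k h \<C>. 0 \<le> mtrace (choi k h \<psi> * choi k h \<phi>)"
  show "C_positive k h \<C> \<phi>"
    unfolding C_positive_def
  proof (intro conjI ballI)
    fix a assume a: "a \<in> PBC k h \<C>"
    then have "a \<in> carrier_mat (k * h) (k * h)" by (simp add: PBC_def)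
    then show "0 \<le> tilde k h \<phi> a"
      using R[rule_format, OF transpose_PBC_dual[OF a]] assms
      by (simp add: tilde_eq_mtrace choi_map_of_choi)
  qed (rule assms)
qed (auto simp: P_C_dual_def)

section \<open>Normalized elements of the dual cone\<close>

lemma ampl_one_psd:
  assumes "positive_map h h \<alpha>"
  shows "psd (k * h) (ampl k h h \<alpha> (1\<^sub>m (k * h)))"
proof -
  have lin: "lin_map h h \<alpha>" and P: "psd h (\<alpha> (1\<^sub>m h))"
    using assms psd_one by (auto simp: positive_map_def)
  have "\<alpha> (0 \<cdot>\<^sub>m 1\<^sub>m h) = 0 \<cdot>\<^sub>m \<alpha> (1\<^sub>m h)"
    using lin by (simp add: lin_map_def)
  moreover have "0 \<cdot>\<^sub>m A = 0\<^sub>m h h" if "A \<in> carrier_mat h h" for A :: "complex mat"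
    using that by (intro eq_matI) auto
  ultimately have zero: "\<alpha> (0\<^sub>m h h) = 0\<^sub>m h h"
    using psd_carrier[OF P] by simp
  \<comment> \<open>The amplified identity is block diagonal with k copies of the positive matrix
    \<open>\<alpha> (1\<^sub>m h)\<close>, since off-diagonal blocks are images of zero.\<close>
  have ent: "ampl k h h \<alpha> (1\<^sub>m (k * h)) $$ (m * h + p, m' * h + q) =
      (if m = m' then \<alpha> (1\<^sub>m h) $$ (p, q) else 0)"
    if "m < k" "m' < k" "p < h" "q < h" for m m' p q
  proof -
    have "m * h + a = m' * h + b \<longleftrightarrow> m = m' \<and> a = b" if "a < h" "b < h" for a b
      using that by (metis add.commute div_mult_self1_is_m div_mult_self3 mod_mult_self3 mod_less div_less add_0 less_nat_zero_code mult.commute neq0_conv)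
    then have "blk h (1\<^sub>m (k * h)) m m' = (if m = m' then 1\<^sub>m h else 0\<^sub>m h h)"
      using that by (auto intro!: eq_matI simp: blk_def mult_add_less_mult)
    then show ?thesis
      using that zero by (simp add: ampl_def mult_add_less_mult)
  qed
  have "(\<Sum>r<k * h. \<Sum>s<k * h. cnj (y r) * ampl k h h \<alpha> (1\<^sub>m (k * h)) $$ (r, s) * y s)
     = (\<Sum>m<k. \<Sum>p<h. \<Sum>q<h. cnj (y (m * h + p)) * \<alpha> (1\<^sub>m h) $$ (p, q) * y (m * h + q))" for y
  proof -
    have "(\<Sum>r<k * h. \<Sum>s<k * h. cnj (y r) * ampl k h h \<alpha> (1\<^sub>m (k * h)) $$ (r, s) * y s)
      = (\<Sum>m<k. \<Sum>p<h. \<Sum>m'<k. \<Sum>q<h. cnj (y (m * h + p)) *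
          (if m = m' then \<alpha> (1\<^sub>m h) $$ (p, q) else 0) * y (m' * h + q))"
      by (simp add: sum_lessThan_mult ent)
    also have "\<dots> = (\<Sum>m<k. \<Sum>p<h. \<Sum>m'<k. if m = m' then
          \<Sum>q<h. cnj (y (m * h + p)) * \<alpha> (1\<^sub>m h) $$ (p, q) * y (m' * h + q) else 0)"
      by (intro sum.cong refl) auto
    finally show ?thesis by simp
  qed
  moreover have "0 \<le> (\<Sum>p<h. \<Sum>q<h. cnj (y (m * h + p)) * \<alpha> (1\<^sub>m h) $$ (p, q) * y (m * h + q))" for y m
    using P unfolding psd_iff_form by (elim conjE allE[of _ "\<lambda>p. y (m * h + p)"])
  ultimately show ?thesis
    unfolding psd_iff_form by (simp add: ampl_def sum_nonneg)
qed

text \<open>The normalized identity is a witness. It keeps the set in the definition of the norm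
  nonempty, so that its \<open>Sup\<close> is meaningful.\<close>

lemma P_C_dual_normalized_exists:
  assumes "mapping_cone h \<C>" "k * h > 0"
  shows "\<exists>\<psi>\<in>P_C_dual k h \<C>. mtrace (choi k h \<psi>) = 1"
proof -
  have "1\<^sub>m (k * h) \<in> PBC k h \<C>"
    using assms(1) ampl_one_psd by (auto simp: PBC_def mapping_cone_def)
  from transpose_PBC_dual[OF this]
  have "map_of_choi k h (1\<^sub>m (k * h)) \<in> P_C_dual k h \<C>"
    by (simp add: transpose_one)
  from P_C_dual_choi_smult[OF this, of "1 / of_nat (k * h)"]
  have "map_of_choi k h ((1 / of_nat (k * h)) \<cdot>\<^sub>m 1\<^sub>m (k * h)) \<in> P_C_dual k h \<C>"
    by (simp add: choi_map_of_choi less_eq_complex_def)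
  moreover have "mtrace ((1 / of_nat (k * h)) \<cdot>\<^sub>m 1\<^sub>m (k * h)) = 1"
    using assms(2) by (simp add: mtrace_def)
  ultimately show ?thesis
    by (metis choi_map_of_choi one_carrier_mat smult_carrier_mat)
qed

section \<open>The norm as a supremum over states\<close>

lemma C_norm_eq_Sup_states:
  assumes "{\<alpha>. CP h h \<alpha>} \<subseteq> \<C>" "psd (k * h) (choi k h \<phi>)"
  shows "C_norm k h \<C> \<phi> = Sup {Re (mtrace (choi k h \<psi> * choi k h \<phi>)) | \<psi>.
    \<psi> \<in> P_C_dual k h \<C> \<and> density_op (k * h) (choi k h \<psi>)}"
proof -
  \<comment> \<open>Both Choi matrices are positive, so the pairing is a nonnegative real and equals
    its modulus. Positivity of the dual element also makes trace 1 the same as being a density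
    operator.\<close>
  have "cmod (mtrace (choi k h \<phi> * choi k h \<psi>)) = Re (mtrace (choi k h \<psi> * choi k h \<phi>))"
    if "\<psi> \<in> P_C_dual k h \<C>" for \<psi>
  proof -
    have "mtrace (choi k h \<phi> * choi k h \<psi>) = mtrace (choi k h \<psi> * choi k h \<phi>)"
      by (simp add: mtrace_mult[of _ "k * h"] mult.commute[of "_ :: complex"] sum.swap[of "\<lambda>r s. choi k h \<phi> $$ (r,s) * _ r s"])
    moreover have "0 \<le> mtrace (choi k h \<psi> * choi k h \<phi>)"
      by (intro mtrace_mult_psd_nonneg[of "k * h"] assms P_C_dual_psd[OF assms(1) that])
    ultimately show ?thesis by (simp add: less_eq_complex_def cmod_eq_Re)
  qed
  then have "{cmod (mtrace (choi k h \<phi> * choi k h \<psi>)) | \<psi>.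
      \<psi> \<in> P_C_dual k h \<C> \<and> mtrace (choi k h \<psi>) = 1} =
    {Re (mtrace (choi k h \<psi> * choi k h \<phi>)) | \<psi>.
      \<psi> \<in> P_C_dual k h \<C> \<and> density_op (k * h) (choi k h \<psi>)}"
    using P_C_dual_psd[OF assms(1)] by (force simp: density_op_def)
  then show ?thesis by (simp add: C_norm_def)
qed

lemma C_norm_le_one_iff:
  assumes C: "mapping_cone h \<C>" "{\<alpha>. CP h h \<alpha>} \<subseteq> \<C>" "k * h > 0"
    and psd: "psd (k * h) (choi k h \<phi>)"
  shows "C_norm k h \<C> \<phi> \<le> 1 \<longleftrightarrow> (\<forall>\<psi>\<in>P_C_dual k h \<C>.
    mtrace (choi k h \<psi> * choi k h \<phi>) \<le> mtrace (choi k h \<psi>))"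
proof -
  let ?S = "{Re (mtrace (choi k h \<psi> * choi k h \<phi>)) | \<psi>.
    \<psi> \<in> P_C_dual k h \<C> \<and> density_op (k * h) (choi k h \<psi>)}"
  let ?N = "op_norm (k * h) (choi k h \<phi>)"
  note dual_psd = P_C_dual_psd[OF C(2)]
  have nonneg: "0 \<le> mtrace (choi k h \<psi> * choi k h \<phi>)" if "\<psi> \<in> P_C_dual k h \<C>" for \<psi>
    by (intro mtrace_mult_psd_nonneg[of "k * h"] psd dual_psd that)
  have bound: "mtrace (choi k h \<psi> * choi k h \<phi>) \<le> complex_of_real ?N * mtrace (choi k h \<psi>)"
    if "\<psi> \<in> P_C_dual k h \<C>" for \<psi>
    by (intro mtrace_mult_le_op_norm psd dual_psd that)
  \<comment> \<open>Boundedness and nonemptiness make the real \<open>Sup\<close> a true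
    supremum.\<close>
  have bdd: "bdd_above ?S"
    using bound by (intro bdd_aboveI[of _ ?N]) (force simp: density_op_def less_eq_complex_def)
  have ne: "?S \<noteq> {}"
    using P_C_dual_normalized_exists[OF C(1,3)] dual_psd by (auto simp: density_op_def)
  have Sup: "C_norm k h \<C> \<phi> = Sup ?S"
    by (rule C_norm_eq_Sup_states[OF C(2) psd])
  show ?thesis
  proof
    assume le: "C_norm k h \<C> \<phi> \<le> 1"
    show "\<forall>\<psi>\<in>P_C_dual k h \<C>. mtrace (choi k h \<psi> * choi k h \<phi>) \<le> mtrace (choi k h \<psi>)"
    proof
      fix \<psi> assume \<psi>: "\<psi> \<in> P_C_dual k h \<C>"
      let ?t = "mtrace (choi k h \<psi>)"
      have "0 \<le> mtrace (choi k h \<psi> * 1\<^sub>m (k * h))"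
        by (intro mtrace_mult_psd_nonneg[of "k * h"] psd_one dual_psd \<psi>)
      then have t: "0 \<le> ?t"
        using right_mult_one_mat[OF choi_carrier] by simp
      show "mtrace (choi k h \<psi> * choi k h \<phi>) \<le> ?t"
      proof (cases "?t = 0")
        case True
        \<comment> \<open>An element of trace zero cannot be normalized; here the operator norm
          bound itself reads that the pairing is at most 0.\<close>
        then show ?thesis using bound[OF \<psi>] by simp
      next
        case False
        then have t': "0 < Re ?t" "?t = complex_of_real (Re ?t)"
          using t by (auto simp: less_eq_complex_def complex_eq_iff)
        let ?D = "(1 / ?t) \<cdot>\<^sub>m choi k h \<psi>"
        let ?\<psi>' = "map_of_choi k h ?D"
        have ch: "choi k h ?\<psi>' = ?D"
          by (rule choi_map_of_choi) simp
        have dual: "?\<psi>' \<in> P_C_dual k h \<C>"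
          using t t' \<psi> by (intro P_C_dual_choi_smult) (auto simp: less_eq_complex_def Re_divide Im_divide)
        have "mtrace ?D = 1"
          using False by (simp add: mtrace_smult[OF choi_carrier])
        then have "density_op (k * h) (choi k h ?\<psi>')"
          using dual_psd[OF dual] ch by (simp add: density_op_def)
        then have "Re (mtrace (choi k h ?\<psi>' * choi k h \<phi>)) \<in> ?S"
          using dual by blast
        then have "Re (mtrace (choi k h ?\<psi>' * choi k h \<phi>)) \<le> 1"
          using cSup_upper[OF _ bdd] le Sup by force
        also have "choi k h ?\<psi>' * choi k h \<phi> = (1 / ?t) \<cdot>\<^sub>m (choi k h \<psi> * choi k h \<phi>)"
          unfolding ch by (rule mult_smult_assoc_mat[OF choi_carrier choi_carrier])
        also have "mtrace \<dots> = mtrace (choi k h \<psi> * choi k h \<phi>) / complex_of_real (Re ?t)"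
          using t'(2) by (simp add: mtrace_smult[OF mult_carrier_mat[OF choi_carrier choi_carrier]])
        finally have "Re (mtrace (choi k h \<psi> * choi k h \<phi>)) \<le> Re ?t"
          using t'(1) by (simp add: Re_divide_of_real)
        \<comment> \<open>The order on complex numbers also demands equal imaginary parts; both
          sides are nonnegative, hence real.\<close>
        then show ?thesis
          using nonneg[OF \<psi>] t by (simp add: less_eq_complex_def)
      qed
    qed
  next
    assume "\<forall>\<psi>\<in>P_C_dual k h \<C>. mtrace (choi k h \<psi> * choi k h \<phi>) \<le> mtrace (choi k h \<psi>)"
    then show "C_norm k h \<C> \<phi> \<le> 1"
      unfolding Sup by (intro cSup_least ne) (force simp: density_op_def less_eq_complex_def)
  qed
qed

section \<open>The decomposition of \<phi> and the norm criterion for \<C>-positivity\<close>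

theorem theorem1:
  fixes k h :: nat and \<phi> :: "complex mat \<Rightarrow> complex mat" and Cp Cm :: "complex mat"
  assumes sa: "self_adjoint_map k h \<phi>"
    and notcp: "\<not> CP k h (\<lambda>x. - \<phi> x)"
    and Cp: "psd (k * h) Cp" and Cm: "psd (k * h) Cm"
    and dec: "choi k h \<phi> = Cp - Cm"
    and orth: "Cp * Cm = 0\<^sub>m (k * h) (k * h)"
  shows "\<exists>\<phi>cp. CP k h \<phi>cp \<and>
     (\<forall>x \<in> carrier_mat k k.
        complex_of_real (1 / op_norm (k * h) Cp) \<cdot>\<^sub>m \<phi> x = mtrace x \<cdot>\<^sub>m 1\<^sub>m h - \<phi>cp x) \<and>
     (\<forall>\<C>. mapping_cone h \<C> \<and> {\<alpha>. CP h h \<alpha>} \<subseteq> \<C> \<longrightarrow>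
        C_norm k h \<C> \<phi>cp =
          Sup {Re (mtrace (choi k h \<psi> * choi k h \<phi>cp)) | \<psi>.
                 \<psi> \<in> P_C_dual k h \<C> \<and> density_op (k * h) (choi k h \<psi>)} \<and>
        (C_positive k h \<C> \<phi> \<longleftrightarrow> C_norm k h \<C> \<phi>cp \<le> 1))"
proof -
  let ?n = "k * h"
  have lin: "lin_map k h \<phi>"
    using sa by (simp add: self_adjoint_map_def)
  then have car: "\<phi> x \<in> carrier_mat h h" if "x \<in> carrier_mat k k" for x
    using that by (simp add: lin_map_def)
  have smult: "\<phi> (c \<cdot>\<^sub>m a) = c \<cdot>\<^sub>m \<phi> a" if "a \<in> carrier_mat k k" for c a
    using lin that by (simp add: lin_map_def)
  have add: "\<phi> (a + b) = \<phi> a + \<phi> b" if "a \<in> carrier_mat k k" "b \<in> carrier_mat k k" for a b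
    using lin that by (simp add: lin_map_def)
  have Cpm: "Cp \<in> carrier_mat ?n ?n" "Cm \<in> carrier_mat ?n ?n"
    using Cp Cm by (auto intro: psd_carrier)
  have "Cp \<noteq> 0\<^sub>m ?n ?n"
  proof
    assume "Cp = 0\<^sub>m ?n ?n"
    have "lin_map k h (\<lambda>x. - \<phi> x)"
      unfolding lin_map_def
    proof (intro conjI ballI allI)
      fix a b :: "complex mat" and c
      assume a: "a \<in> carrier_mat k k"
      show "- \<phi> a \<in> carrier_mat h h" using car[OF a] by simp
      show "- \<phi> (c \<cdot>\<^sub>m a) = c \<cdot>\<^sub>m - \<phi> a"
        unfolding smult[OF a] using car[OF a] by (intro eq_matI) auto
      assume b: "b \<in> carrier_mat k k"
      show "- \<phi> (a + b) = - \<phi> a + - \<phi> b"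
        unfolding add[OF a b] using car[OF a] car[OF b] by (intro eq_matI) auto
    qed
    moreover have "choi k h (\<lambda>x. - \<phi> x) = - choi k h \<phi>"
    proof (rule eq_matI)
      fix r s assume "r < dim_row (- choi k h \<phi>)" "s < dim_col (- choi k h \<phi>)"
      then have "r < ?n" "s < ?n" by (auto simp: choi_def)
      moreover from this have "h > 0" by (cases h) auto
      ultimately show "choi k h (\<lambda>x. - \<phi> x) $$ (r, s) = (- choi k h \<phi>) $$ (r, s)"
        using carrier_matD[OF car[OF munit_carrier]] by (simp add: choi_def)
    qed (auto simp: choi_def)
    moreover have "- choi k h \<phi> = Cm"
      using Cpm \<open>Cp = _\<close> unfolding dec by (intro eq_matI) auto
    ultimately show False
      using notcp Cm CP_of_psd_choi by simp
  qed
  then have N: "0 < op_norm ?n Cp"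
    by (intro op_norm_pos Cpm)
  \<comment> \<open>In dimension 0 every matrix is the zero matrix, which \<open>Cp\<close> is
    not.\<close>
  then have pos: "?n > 0"
    using \<open>Cp \<noteq> _\<close> Cpm by (intro gr0I) (auto intro: eq_matI)
  define c where "c = complex_of_real (1 / op_norm ?n Cp)"
  \<comment> \<open>The required identity in (i) forces this definition; only complete positivity
    remains to be shown.\<close>
  define \<phi>cp where "\<phi>cp x = mtrace x \<cdot>\<^sub>m 1\<^sub>m h - c \<cdot>\<^sub>m \<phi> x" for x
  have lin': "lin_map k h \<phi>cp"
    unfolding lin_map_def
  proof (intro conjI ballI allI)
    fix a b :: "complex mat" and d
    assume a: "a \<in> carrier_mat k k"
    show "\<phi>cp a \<in> carrier_mat h h" using car[OF a] by (auto simp: \<phi>cp_def)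
    show "\<phi>cp (d \<cdot>\<^sub>m a) = d \<cdot>\<^sub>m \<phi>cp a"
      unfolding \<phi>cp_def smult[OF a] mtrace_smult[OF a] using car[OF a]
      by (intro eq_matI) (auto simp: algebra_simps)
    assume b: "b \<in> carrier_mat k k"
    show "\<phi>cp (a + b) = \<phi>cp a + \<phi>cp b"
      unfolding \<phi>cp_def add[OF a b] mtrace_add[OF a b] using car[OF a] car[OF b]
      by (intro eq_matI) (auto simp: algebra_simps)
  qed
  have choi_cp: "choi k h \<phi>cp = 1\<^sub>m ?n - c \<cdot>\<^sub>m choi k h \<phi>"
  proof (rule eq_matI)
    fix r s assume "r < dim_row (1\<^sub>m ?n - c \<cdot>\<^sub>m choi k h \<phi>)" "s < dim_col (1\<^sub>m ?n - c \<cdot>\<^sub>m choi k h \<phi>)"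
    then have rs: "r < ?n" "s < ?n" by (auto simp: choi_def)
    then have h: "h > 0" by (cases h) auto
    have lt: "r div h < k" "s div h < k" "r mod h < h" "s mod h < h"
      using rs h by (simp_all add: less_mult_imp_div_less)
    have tr: "mtrace (munit k i j) = (if i = j then 1 else 0)" if "i < k" "j < k" for i j
      using that by (cases "i = j") (auto simp: mtrace_def munit_def intro!: sum.neutral)
    have "r = s \<longleftrightarrow> r div h = s div h \<and> r mod h = s mod h"
      by (metis div_mult_mod_eq)
    then show "choi k h \<phi>cp $$ (r, s) = (1\<^sub>m ?n - c \<cdot>\<^sub>m choi k h \<phi>) $$ (r, s)"
      using rs lt carrier_matD[OF car[OF munit_carrier]] by (auto simp: choi_def \<phi>cp_def tr)
  qed (auto simp: choi_def)
  also have "\<dots> = c \<cdot>\<^sub>m ((complex_of_real (op_norm ?n Cp) \<cdot>\<^sub>m 1\<^sub>m ?n - Cp) + Cm)"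
    using N Cpm unfolding dec by (intro eq_matI) (auto simp: c_def field_simps)
  also have "psd ?n \<dots>"
    using N by (intro psd_smult psd_add psd_op_norm_minus Cp Cm) (simp add: c_def less_eq_complex_def)
  finally have psd_cp: "psd ?n (choi k h \<phi>cp)" .
  have dual: "C_positive k h \<C> \<phi> \<longleftrightarrow> C_norm k h \<C> \<phi>cp \<le> 1"
    if C: "mapping_cone h \<C>" "{\<alpha>. CP h h \<alpha>} \<subseteq> \<C>" for \<C>
  proof -
    \<comment> \<open>For each \<psi> the pairing with \<phi>cp is the trace minus c times the
      pairing with \<phi>, and c is a positive real.\<close>
    have "0 \<le> mtrace (choi k h \<psi> * choi k h \<phi>) \<longleftrightarrow>
       mtrace (choi k h \<psi> * choi k h \<phi>cp) \<le> mtrace (choi k h \<psi>)" for \<psi>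
    proof -
      have "choi k h \<psi> * choi k h \<phi>cp = choi k h \<psi> - c \<cdot>\<^sub>m (choi k h \<psi> * choi k h \<phi>)"
        unfolding choi_cp
        by (subst mult_minus_distrib_mat[of _ ?n ?n _ ?n])
          (auto simp: right_mult_one_mat[OF choi_carrier] mult_smult_distrib[OF choi_carrier choi_carrier])
      then have "mtrace (choi k h \<psi> * choi k h \<phi>cp)
          = mtrace (choi k h \<psi>) - c * mtrace (choi k h \<psi> * choi k h \<phi>)"
        by (simp add: mtrace_diff[of _ ?n] mtrace_smult[of _ ?n] mult_carrier_mat[OF choi_carrier choi_carrier])
      then show ?thesis
        using N by (simp add: c_def less_eq_complex_def zero_le_divide_iff)
    qed
    then show ?thesis
      unfolding C_positive_iff_dual[OF lin] C_norm_le_one_iff[OF C pos psd_cp] by simp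
  qed
  have "c \<cdot>\<^sub>m \<phi> x = mtrace x \<cdot>\<^sub>m 1\<^sub>m h - \<phi>cp x" if "x \<in> carrier_mat k k" for x
    using car[OF that] by (intro eq_matI) (auto simp: \<phi>cp_def)
  then show ?thesis
    using CP_of_psd_choi[OF lin' psd_cp] C_norm_eq_Sup_states[OF _ psd_cp] dual
    unfolding c_def[symmetric] by (intro exI[of _ \<phi>cp]) blast
qed

end
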